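(* There exist an undirected weighted $n$-node graph $G$ and a single node pair $(s,t)$ such that every $2$-FT $(s,t)$ preserver of $G$ has $\Omega(n^2)$ edges. Moreover, any exact $2$-FT distance sensitivity oracle for a single pair $(s,t)$ in $n$-node undirected weighted graphs uses $\Omega(n^2)$ bits of space in the worst case.
   Context: A subgraph $H\subseteq G=(V,E)$ is a $2$-FT $(s,t)$ preserver if $\mathrm{dist}_{H\setminus F}(s,t)=\mathrm{dist}_{G\setminus F}(s,t)$ for every $F\subseteq E$ with $|F|\leq 2$. An exact $2$-FT distance sensitivity oracle for $(s,t)$ is a data structure built from $G$ that, given any $F\subseteq E$ with $|F|\leq 2$, returns $\mathrm{dist}_{G\setminus F}(s,t)$ exactly. *)

theory Defs
  imports Complex_Main "HOL-Library.Extended_Real"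
begin

text \<open>
  A simple undirected weighted graph is a vertex set together with a partial map that sends each
  edge, an unordered pair of vertices, to its weight. The edge set is the domain of that map, so a
  graph carries no weight information about non-edges.
\<close>

record 'v wgraph =
  verts :: "'v set"
  weight :: "'v set \<Rightarrow> real option"

definition edges :: "'v wgraph \<Rightarrow> 'v set set" where
  "edges G = dom (weight G)"

definition weighted_graph :: "'v wgraph \<Rightarrow> bool" where
  "weighted_graph G \<longleftrightarrow>
     finite (verts G) \<and>
     (\<forall>e \<in> edges G. e \<subseteq> verts G \<and> card e = 2) \<and>
     (\<forall>x \<in> ran (weight G). x > 0)"

definition subgraph :: "'v wgraph \<Rightarrow> 'v wgraph \<Rightarrow> bool" where
  "subgraph H G \<longleftrightarrow>
     weighted_graph H \<and> verts H \<subseteq> verts G \<and> weight H \<subseteq>\<^sub>m weight G"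

definition delete_edges :: "'v wgraph \<Rightarrow> 'v set set \<Rightarrow> 'v wgraph" where
  "delete_edges G F = G\<lparr>weight := weight G |` (- F)\<rparr>"

text \<open>Walks are given by their vertex sequences.\<close>

definition walk :: "'v wgraph \<Rightarrow> 'v \<Rightarrow> 'v list \<Rightarrow> 'v \<Rightarrow> bool" where
  "walk G u p v \<longleftrightarrow>
     p \<noteq> [] \<and> hd p = u \<and> last p = v \<and> set p \<subseteq> verts G \<and>
     successively (\<lambda>x y. {x, y} \<in> edges G) p"

definition walk_length :: "'v wgraph \<Rightarrow> 'v list \<Rightarrow> real" where
  "walk_length G p = sum_list (map2 (\<lambda>x y. the (weight G {x, y})) p (tl p))"

text \<open>The infimum over the empty set is \<open>\<infinity>\<close>: this is the distance of disconnected vertices.\<close>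

definition wdist :: "'v wgraph \<Rightarrow> 'v \<Rightarrow> 'v \<Rightarrow> ereal" where
  "wdist G u v = (INF p \<in> {p. walk G u p v}. ereal (walk_length G p))"

definition ft_preserver :: "nat \<Rightarrow> 'v wgraph \<Rightarrow> 'v \<Rightarrow> 'v \<Rightarrow> 'v wgraph \<Rightarrow> bool" where
  "ft_preserver f G s t H \<longleftrightarrow>
     subgraph H G \<and>
     (\<forall>F \<subseteq> edges G. finite F \<and> card F \<le> f \<longrightarrow>
        wdist (delete_edges H F) s t = wdist (delete_edges G F) s t)"

text \<open>
  A data structure for a class of graphs is a preprocessing map \<open>build\<close> from graphs to bit strings
  together with a procedure \<open>query\<close> that sees only the bit string and the fault set. Both are
  arbitrary functions and may depend on the class and on \<open>(s, t)\<close>. The space used on \<open>G\<close> is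
  \<open>length (build G)\<close>.
\<close>

definition exact_ft_oracle ::
    "nat \<Rightarrow> 'v wgraph set \<Rightarrow> 'v \<Rightarrow> 'v \<Rightarrow>
     ('v wgraph \<Rightarrow> bool list) \<Rightarrow> (bool list \<Rightarrow> 'v set set \<Rightarrow> ereal) \<Rightarrow> bool" where
  "exact_ft_oracle f \<G> s t build query \<longleftrightarrow>
     (\<forall>G \<in> \<G>. \<forall>F \<subseteq> edges G. finite F \<and> card F \<le> f \<longrightarrow>
        query (build G) F = wdist (delete_edges G F) s t)"

text \<open>
  The \<open>n\<close>-node graphs with vertices labelled \<open>0, \<dots>, n - 1\<close> and weights from \<open>W\<close>. The weight set
  is a parameter because arbitrary real (or unboundedly large integer) weights would make any
  worst-case bound in bits trivial, a single distance then being unboundedly expensive to store.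
\<close>

definition graphs_on :: "nat \<Rightarrow> real set \<Rightarrow> nat wgraph set" where
  "graphs_on n W = {G. weighted_graph G \<and> verts G = {..<n} \<and> ran (weight G) \<subseteq> W}"

end

theory Submission
  imports Defs "HOL-Combinatorics.Transposition"
begin

text \<open>
  Take two disjoint unit-weight paths \<open>a 0, \<dots>, a k\<close> and \<open>b 0, \<dots>, b k\<close> with \<open>s = a 0\<close> and
  \<open>t = b 0\<close>, and cross edges from \<open>a i\<close> to \<open>b j\<close> of weight \<open>8 k - 2 i - 2 j\<close>. Entering at
  \<open>a 0\<close>, crossing once from \<open>a x\<close> to \<open>b y\<close> and leaving at \<open>b 0\<close> costs \<open>8 k - x - y\<close>, and
  crossing three times is too expensive. If the path edges just behind \<open>a i\<close> and \<open>b j\<close> fail, only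
  \<open>x \<le> i\<close> and \<open>y \<le> j\<close> remain, so the distance is \<open>8 k - i - j\<close> if the edge from \<open>a i\<close> to \<open>b j\<close>
  is present and larger otherwise. Hence a preserver keeps all \<open>k\<^sup>2\<close> cross edges, and an oracle
  distinguishes all \<open>2\<close>-to-the-\<open>k\<^sup>2\<close> graphs obtained by choosing a subset of them.
  The lower bound on the distance is certified by a potential, that is, a dual solution of the
  shortest path problem.
\<close>

section \<open>Bounding distances by potentials from below and by walks from above\<close>

text \<open>The differences of \<open>f\<close> telescope along the walk. Since edges are unordered,
  the hypothesis may name the endpoints in either order; the absolute value makes this
  harmless.\<close>

lemma potential_le_walk_length:
  assumes "\<And>e. e \<in> edges G \<Longrightarrow> \<exists>x y. e = {x, y} \<and> \<bar>f x - f y\<bar> \<le> the (weight G e)"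
    and "walk G u p v"
  shows "f v - f u \<le> walk_length G p"
  using assms(2)
proof (induction p arbitrary: u)
  case Nil
  then show ?case by (simp add: walk_def)
next
  case (Cons x p)
  show ?case
  proof (cases p)
    case Nil
    with Cons.prems show ?thesis by (auto simp: walk_def walk_length_def)
  next
    case p: (Cons y q)
    have e: "{x, y} \<in> edges G" and u: "u = x" and "walk G y p v"
      using Cons.prems by (auto simp: walk_def p)
    then have "f v - f y \<le> walk_length G p" using Cons.IH by blast
    moreover obtain x' y' where "{x, y} = {x', y'}" "\<bar>f x' - f y'\<bar> \<le> the (weight G {x, y})"
      using assms(1)[OF e] by blast
    then have "f y - f x \<le> the (weight G {x, y})"
      by (auto simp: doubleton_eq_iff)
    ultimately show ?thesis by (simp add: u p walk_length_def)
  qed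
qed

lemma potential_le_wdist:
  assumes "\<And>e. e \<in> edges G \<Longrightarrow> \<exists>x y. e = {x, y} \<and> \<bar>f x - f y\<bar> \<le> the (weight G e)"
  shows "ereal (f v - f u) \<le> wdist G u v"
  unfolding wdist_def by (rule INF_greatest) (use potential_le_walk_length[OF assms] in auto)

lemma walk_step:
  assumes "weight G {u, v} = Some w" "u \<in> verts G" "\<exists>p. walk G v p t \<and> walk_length G p = l"
  shows "\<exists>p. walk G u p t \<and> walk_length G p = w + l"
proof -
  obtain p where p: "walk G v p t" "walk_length G p = l" using assms(3) by blast
  then obtain q where q: "p = v # q" by (cases p) (auto simp: walk_def)
  have "walk G u (u # p) t" using p assms by (auto simp: walk_def q edges_def)
  moreover have "walk_length G (u # p) = w + l"
    using p assms by (simp add: walk_length_def q)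
  ultimately show ?thesis by blast
qed

text \<open>Walks grow only at their front, so the induction on \<open>m\<close> moves the last path
  edge into the continuation; hence \<open>l\<close> must be arbitrary.\<close>

lemma walk_along_path:
  fixes w :: real
  assumes "\<And>x. x < m \<Longrightarrow> weight G {c x, c (Suc x)} = Some w" "\<And>x. x \<le> m \<Longrightarrow> c x \<in> verts G"
    and "\<exists>p. walk G (c m) p t \<and> walk_length G p = l"
  shows "\<exists>p. walk G (c 0) p t \<and> walk_length G p = m * w + l"
  using assms
proof (induction m arbitrary: l)
  case (Suc m)
  have "\<exists>p. walk G (c m) p t \<and> walk_length G p = w + l"
    using Suc.prems by (intro walk_step[of G "c m" "c (Suc m)"]) auto
  from Suc.IH[OF _ _ this] Suc.prems show ?case by (auto simp: algebra_simps)
qed auto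

lemma walk_against_path:
  fixes w :: real
  assumes "\<And>x. x < m \<Longrightarrow> weight G {c x, c (Suc x)} = Some w" "\<And>x. x \<le> m \<Longrightarrow> c x \<in> verts G"
  shows "\<exists>p. walk G (c m) p (c 0) \<and> walk_length G p = m * w"
  using assms
proof (induction m)
  case 0
  then show ?case by (intro exI[of _ "[c 0]"]) (simp add: walk_def walk_length_def)
next
  case (Suc m)
  have "\<exists>p. walk G (c (Suc m)) p (c 0) \<and> walk_length G p = w + m * w"
    using Suc by (intro walk_step[of G "c (Suc m)" "c m"]) (auto simp: insert_commute)
  then show ?case by (simp add: algebra_simps)
qed

section \<open>The gadget graph on two disjoint paths\<close>

text \<open>\<open>V\<close> may exceed the two paths: the remaining vertices are isolated in the
  gadget and pad it to any size.\<close>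

locale two_paths =
  fixes a b :: "nat \<Rightarrow> 'v" and k :: nat and V :: "'v set"
  assumes inj_a: "inj_on a {..k}" and inj_b: "inj_on b {..k}"
    and disj: "a ` {..k} \<inter> b ` {..k} = {}"
    and finV: "finite V" and aV: "a ` {..k} \<subseteq> V" and bV: "b ` {..k} \<subseteq> V"
begin

text \<open>Turns functions of the position on each path into one function of the vertex. Values off
  both paths are arbitrary, but no gadget edge reaches such vertices.\<close>

definition glue :: "(nat \<Rightarrow> 'c) \<Rightarrow> (nat \<Rightarrow> 'c) \<Rightarrow> 'v \<Rightarrow> 'c" where
  "glue f g v = (if v \<in> a ` {..k} then f (inv_into {..k} a v) else g (inv_into {..k} b v))"

lemma glue_a [simp]: "x \<le> k \<Longrightarrow> glue f g (a x) = f x"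
  using inj_a by (auto simp: glue_def)

lemma glue_b [simp]: "x \<le> k \<Longrightarrow> glue f g (b x) = g x"
  using inj_b disj by (auto simp: glue_def)

lemma a_eq [simp]: "x \<le> k \<Longrightarrow> y \<le> k \<Longrightarrow> a x = a y \<longleftrightarrow> x = y"
  using inj_a by (auto simp: inj_on_def)

lemma b_eq [simp]: "x \<le> k \<Longrightarrow> y \<le> k \<Longrightarrow> b x = b y \<longleftrightarrow> x = y"
  using inj_b by (auto simp: inj_on_def)

lemma a_neq_b [simp]: "x \<le> k \<Longrightarrow> y \<le> k \<Longrightarrow> a x \<noteq> b y" "x \<le> k \<Longrightarrow> y \<le> k \<Longrightarrow> b y \<noteq> a x"
  using disj by force+

definition path_edges :: "'v set set" where
  "path_edges = (\<lambda>x. {a x, a (Suc x)}) ` {..<k} \<union> (\<lambda>x. {b x, b (Suc x)}) ` {..<k}"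

definition cross_edge :: "nat \<times> nat \<Rightarrow> 'v set" where
  "cross_edge = (\<lambda>(x, y). {a x, b y})"

text \<open>Summing positions over \<open>e\<close> recovers \<open>x + y\<close> from the unordered
  pair \<open>{a x, b y}\<close>. The natural subtraction does not truncate for
  \<open>x, y < k\<close>.\<close>

definition gadget :: "(nat \<times> nat) set \<Rightarrow> 'v wgraph" where
  "gadget S = \<lparr>verts = V, weight = (\<lambda>e.
     if e \<in> path_edges then Some 1
     else if e \<in> cross_edge ` S then Some (real (8 * k - 2 * (\<Sum>v\<in>e. glue id id v)))
     else None)\<rparr>"

definition faults :: "nat \<Rightarrow> nat \<Rightarrow> 'v set set" where
  "faults i j = {{a i, a (Suc i)}, {b j, b (Suc j)}}"

abbreviation grid :: "(nat \<times> nat) set" where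
  "grid \<equiv> {..<k} \<times> {..<k}"

lemma verts_gadget [simp]: "verts (gadget S) = V"
  by (simp add: gadget_def)

lemma edges_gadget: "edges (gadget S) = path_edges \<union> cross_edge ` S"
  by (auto simp: edges_def gadget_def dom_def)

lemma cross_edge_not_path: "z \<in> grid \<Longrightarrow> cross_edge z \<notin> path_edges"
  by (auto simp: cross_edge_def path_edges_def doubleton_eq_iff)

lemma inj_cross_edge: "inj_on cross_edge grid"
  by (auto simp: inj_on_def cross_edge_def doubleton_eq_iff)

lemma weight_path: "e \<in> path_edges \<Longrightarrow> weight (gadget S) e = Some 1"
  by (simp add: gadget_def)

lemma weight_cross:
  assumes "(x, y) \<in> S" "S \<subseteq> grid"
  shows "weight (gadget S) (cross_edge (x, y)) = Some (8 * k - 2 * x - 2 * y)"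
proof -
  have xy: "x < k" "y < k" using assms by auto
  then have "cross_edge (x, y) \<notin> path_edges" using cross_edge_not_path by auto
  moreover have "(\<Sum>v\<in>cross_edge (x, y). glue id id v) = x + y"
    using xy by (simp add: cross_edge_def)
  ultimately show ?thesis using assms xy by (simp add: gadget_def)
qed

text \<open>Used both for positivity of the weights and to fit them into the polynomially bounded
  weight set of the oracle bound.\<close>

lemma ran_gadget: "S \<subseteq> grid \<Longrightarrow> ran (weight (gadget S)) \<subseteq> real ` {1..max 1 (8 * k)}"
proof
  fix w assume S: "S \<subseteq> grid" and "w \<in> ran (weight (gadget S))"
  then obtain e where e: "weight (gadget S) e = Some w" by (auto simp: ran_def)
  then have "e \<in> path_edges \<union> cross_edge ` S" unfolding edges_gadget[symmetric]
    by (auto simp: edges_def)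
  then show "w \<in> real ` {1..max 1 (8 * k)}"
  proof
    assume "e \<in> path_edges"
    with e weight_path show ?thesis by force
  next
    assume "e \<in> cross_edge ` S"
    then obtain x y where xy: "(x, y) \<in> S" "e = cross_edge (x, y)" by auto
    then have "w = real (8 * k - 2 * x - 2 * y)" using e weight_cross[OF _ S] by auto
    moreover have "x < k" "y < k" using xy S by auto
    ultimately show ?thesis by (intro image_eqI[of _ _ "8 * k - 2 * x - 2 * y"]) auto
  qed
qed

lemma weighted_graph_gadget:
  assumes "S \<subseteq> grid"
  shows "weighted_graph (gadget S)"
proof -
  have "e \<subseteq> V \<and> card e = 2" if "e \<in> path_edges \<union> cross_edge ` S" for e
    using that assms aV bV by (auto simp: path_edges_def cross_edge_def image_subset_iff)
  moreover have "x > 0" if "x \<in> ran (weight (gadget S))" for x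
    using ran_gadget[OF assms] that by fastforce
  ultimately show ?thesis using finV by (simp add: weighted_graph_def edges_gadget)
qed

lemma faults_path: "i < k \<Longrightarrow> j < k \<Longrightarrow> faults i j \<subseteq> path_edges"
  by (auto simp: faults_def path_edges_def)

lemma finite_faults: "finite (faults i j)" "card (faults i j) \<le> 2"
  by (auto simp: faults_def card_insert_if)

lemma gadget_mono: "S \<subseteq> grid \<Longrightarrow> weight (gadget S) \<subseteq>\<^sub>m weight (gadget grid)"
  by (auto simp: map_le_def gadget_def dom_def)

section \<open>Distances after the two faults\<close>

lemma wdist_faults_le:
  assumes S: "S \<subseteq> grid" and ij: "(i, j) \<in> S"
  shows "wdist (delete_edges (gadget S) (faults i j)) (a 0) (b 0) \<le> ereal (8 * real k - i - j)"
proof -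
  let ?G = "delete_edges (gadget S) (faults i j)"
  have k: "i < k" "j < k" using assms by auto
  have V: "verts ?G = V" by (simp add: delete_edges_def)
  have W: "weight ?G e = (if e \<in> faults i j then None else weight (gadget S) e)" for e
    by (simp add: delete_edges_def restrict_map_def)
  have wa: "weight ?G {a x, a (Suc x)} = Some 1" if "x < i" for x
  proof -
    have "{a x, a (Suc x)} \<in> path_edges" using that k by (auto simp: path_edges_def)
    then show ?thesis unfolding W using that k
      by (simp add: weight_path faults_def doubleton_eq_iff)
  qed
  have wb: "weight ?G {b x, b (Suc x)} = Some 1" if "x < j" for x
  proof -
    have "{b x, b (Suc x)} \<in> path_edges" using that k by (auto simp: path_edges_def)
    then show ?thesis unfolding W using that k
      by (simp add: weight_path faults_def doubleton_eq_iff)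
  qed
  have wc: "weight ?G {a i, b j} = Some (8 * k - 2 * i - 2 * j)"
    using weight_cross[OF ij S] k
    unfolding W by (simp add: cross_edge_def faults_def doubleton_eq_iff)
  \<comment> \<open>The walk is assembled from its far end: the \<open>b\<close>-path, then the
    cross edge, then the \<open>a\<close>-path.\<close>
  have "\<exists>p. walk ?G (b j) p (b 0) \<and> walk_length ?G p = real j * 1"
    using wb bV k by (intro walk_against_path) (auto simp: V)
  then have "\<exists>p. walk ?G (a i) p (b 0) \<and> walk_length ?G p = real (8 * k - 2 * i - 2 * j) + real j * 1"
    using wc aV k by (intro walk_step) (auto simp: V)
  then have "\<exists>p. walk ?G (a 0) p (b 0) \<and>
      walk_length ?G p = real i * 1 + (real (8 * k - 2 * i - 2 * j) + real j * 1)"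
    using wa aV k by (intro walk_along_path) (auto simp: V)
  then obtain p where p: "walk ?G (a 0) p (b 0)"
    "walk_length ?G p = real i * 1 + (real (8 * k - 2 * i - 2 * j) + real j * 1)" by blast
  have "walk_length ?G p = 8 * real k - i - j" using p(2) k by (simp add: of_nat_diff)
  then show ?thesis unfolding wdist_def using p(1) by (intro INF_lower2[of p]) auto
qed

text \<open>
  The potential is the distance from \<open>a 0\<close> on the part of the \<open>a\<close>-path that is still attached to
  it, the target value minus the distance to \<open>b 0\<close> on the corresponding part of the \<open>b\<close>-path, and
  half the base weight \<open>8 k\<close> on the detached parts.
\<close>

lemma wdist_faults_ge:
  assumes H: "weight H \<subseteq>\<^sub>m weight (gadget grid)" and nin: "cross_edge (i, j) \<notin> edges H"
    and k: "i < k" "j < k"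
  shows "ereal (8 * real k - i - j + 1) \<le> wdist (delete_edges H (faults i j)) (a 0) (b 0)"
proof -
  let ?H = "delete_edges H (faults i j)"
  \<comment> \<open>Without the edge from \<open>a i\<close> to \<open>b j\<close>, every cross edge
    between the attached parts has \<open>x + y \<le> i + j - 1\<close>, which accounts for the
    extra 1.\<close>
  define D where "D = 8 * real k - i - j + 1"
  define f where "f = glue (\<lambda>x. if x \<le> i then real x else 4 * k)
                           (\<lambda>y. if y \<le> j then D - real y else 4 * k)"
  have "\<exists>x y. e = {x, y} \<and> \<bar>f x - f y\<bar> \<le> the (weight ?H e)" if "e \<in> edges ?H" for e
  proof -
    have e: "e \<in> edges H" "e \<notin> faults i j" and "weight ?H e = weight H e"
      using that by (auto simp: edges_def delete_edges_def)
    then have w: "weight ?H e = weight (gadget grid) e" and "e \<in> edges (gadget grid)"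
      using H by (auto simp: map_le_def edges_def dom_def)
    then consider x where "e = {a x, a (Suc x)}" "x < k" | x where "e = {b x, b (Suc x)}" "x < k"
      | x y where "e = cross_edge (x, y)" "x < k" "y < k"
      unfolding edges_gadget path_edges_def by auto
    then show ?thesis
    proof cases
      case 1
      \<comment> \<open>Only the failed edge joins the attached part to the detached one; along any
        other edge of this path \<open>f\<close> changes by 1 or 0.\<close>
      then have "x \<noteq> i" "e \<in> path_edges" using e by (auto simp: faults_def path_edges_def)
      then have "the (weight ?H e) = 1" by (simp add: w weight_path)
      with 1 \<open>x \<noteq> i\<close> show ?thesis
        by (intro exI[of _ "a x"] exI[of _ "a (Suc x)"]) (auto simp: f_def)
    next
      case 2
      then have "x \<noteq> j" "e \<in> path_edges" using e by (auto simp: faults_def path_edges_def)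
      then have "the (weight ?H e) = 1" by (simp add: w weight_path)
      with 2 \<open>x \<noteq> j\<close> show ?thesis
        by (intro exI[of _ "b x"] exI[of _ "b (Suc x)"]) (auto simp: f_def)
    next
      case 3
      have xy: "x + y + 1 \<le> i + j" if "x \<le> i" "y \<le> j"
        using that 3 e nin by (cases "x = i"; cases "y = j") auto
      have "the (weight ?H e) = 8 * real k - 2 * x - 2 * y"
        using 3 weight_cross[of x y grid] unfolding w by (simp add: of_nat_diff)
      \<comment> \<open>With both ends attached, the critical inequality
        \<open>D - x - y \<le> 8 * k - 2 * x - 2 * y\<close> is exactly \<open>xy\<close>. If an end
        is detached, \<open>x, y < k\<close> leaves enough slack.\<close>
      moreover have "\<bar>f (a x) - f (b y)\<bar> \<le> 8 * real k - 2 * x - 2 * y"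
        using 3 k xy by (auto simp: f_def D_def)
      ultimately show ?thesis using 3 by (auto simp: cross_edge_def)
    qed
  qed
  then have "ereal (f (b 0) - f (a 0)) \<le> wdist ?H (a 0) (b 0)"
    by (rule potential_le_wdist)
  then show ?thesis by (simp add: f_def D_def)
qed

text \<open>\<open>S = grid\<close> serves the preserver bound, \<open>H = gadget T\<close> the
  oracle bound.\<close>

lemma wdist_faults_neq:
  assumes "weight H \<subseteq>\<^sub>m weight (gadget grid)" "cross_edge (i, j) \<notin> edges H"
    and "S \<subseteq> grid" "(i, j) \<in> S"
  shows "wdist (delete_edges H (faults i j)) (a 0) (b 0) \<noteq>
         wdist (delete_edges (gadget S) (faults i j)) (a 0) (b 0)"
proof -
  have "ereal (8 * real k - i - j + 1) \<le> wdist (delete_edges H (faults i j)) (a 0) (b 0)"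
    using assms by (intro wdist_faults_ge) auto
  moreover have "wdist (delete_edges (gadget S) (faults i j)) (a 0) (b 0)
      \<le> ereal (8 * real k - i - j)"
    using assms by (intro wdist_faults_le)
  ultimately show ?thesis by (metis ereal_less_eq(3) less_add_one not_le order_trans)
qed

section \<open>Consequences for preservers and oracles\<close>

lemma card_preserver:
  assumes "ft_preserver 2 (gadget grid) (a 0) (b 0) H"
  shows "k ^ 2 \<le> card (edges H)"
proof -
  have H: "weighted_graph H" "weight H \<subseteq>\<^sub>m weight (gadget grid)"
    using assms by (auto simp: ft_preserver_def subgraph_def)
  have "cross_edge ` grid \<subseteq> edges H"
  proof (rule image_subsetI, rule ccontr)
    fix z assume z: "z \<in> grid" "cross_edge z \<notin> edges H"
    then obtain i j where ij: "z = (i, j)" "i < k" "j < k" by auto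
    have "wdist (delete_edges H (faults i j)) (a 0) (b 0) =
          wdist (delete_edges (gadget grid) (faults i j)) (a 0) (b 0)"
      using assms[unfolded ft_preserver_def, THEN conjunct2, rule_format, of "faults i j"]
        faults_path[of i j] ij finite_faults by (simp add: edges_gadget le_supI1)
    with wdist_faults_neq[OF H(2), of i j grid] z ij show False by auto
  qed
  \<comment> \<open>Needed for monotonicity of \<open>card\<close>, which is 0 on infinite
    sets.\<close>
  moreover have "finite (edges H)"
    by (rule finite_subset[of _ "Pow (verts H)"]) (use H in \<open>auto simp: weighted_graph_def\<close>)
  ultimately have "card (cross_edge ` grid) \<le> card (edges H)" by (rule card_mono[rotated])
  then show ?thesis by (simp add: card_image inj_cross_edge power2_eq_square)
qed

text \<open>The faults are path edges, hence legal queries in every gadget. Equal bit strings answer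
  them equally, but a cross edge in only one of two gadgets forces different distances.\<close>

lemma inj_build:
  assumes "exact_ft_oracle 2 \<G> (a 0) (b 0) build query" "gadget ` Pow grid \<subseteq> \<G>"
  shows "inj_on (\<lambda>S. build (gadget S)) (Pow grid)"
proof -
  have sub: "S \<subseteq> T" if ST: "S \<subseteq> grid" "T \<subseteq> grid" "build (gadget S) = build (gadget T)" for S T
  proof (rule subrelI, rule ccontr)
    fix i j assume ij: "(i, j) \<in> S" "(i, j) \<notin> T"
    have F: "faults i j \<subseteq> edges (gadget U)" for U
      using faults_path[of i j] ij ST unfolding edges_gadget by auto
    have "query (build (gadget U)) (faults i j) =
        wdist (delete_edges (gadget U) (faults i j)) (a 0) (b 0)" if "U \<subseteq> grid" for U
      using assms(1)[unfolded exact_ft_oracle_def, rule_format, of "gadget U" "faults i j"]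
        assms(2) that F finite_faults by (simp add: image_subset_iff)
    then have "wdist (delete_edges (gadget T) (faults i j)) (a 0) (b 0) =
        wdist (delete_edges (gadget S) (faults i j)) (a 0) (b 0)"
      using ST by metis
    moreover have "cross_edge (i, j) \<notin> edges (gadget T)"
      using ij ST cross_edge_not_path[of "(i, j)"] inj_on_image_mem_iff[OF inj_cross_edge, of "(i, j)" T]
      unfolding edges_gadget by auto
    ultimately show False
      using wdist_faults_neq[of "gadget T" i j S] gadget_mono ST ij by blast
  qed
  show ?thesis by (rule inj_onI) (metis PowD sub subset_antisym)
qed

end

section \<open>Counting bit strings and placing the paths among \<open>n\<close> labels\<close>

text \<open>Pigeonhole: there are only \<open>2 ^ m - 1\<close> bit strings shorter than
  \<open>m\<close>.\<close>

lemma ex_long_bit_string: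
  fixes f :: "'a \<Rightarrow> bool list"
  assumes "inj_on f A" "finite A" "card A \<ge> 2 ^ m"
  shows "\<exists>x\<in>A. m \<le> length (f x)"
proof (rule ccontr)
  assume "\<not> ?thesis"
  then have "f ` A \<subseteq> (\<Union>l<m. {xs. length xs = l})" by (auto simp: not_le)
  moreover have fin: "finite {xs :: bool list. length xs = l}" for l
    using finite_lists_length_eq[of "UNIV :: bool set" l] by simp
  ultimately have "card (f ` A) \<le> card (\<Union>l<m. {xs :: bool list. length xs = l})"
    by (intro card_mono) auto
  also have "\<dots> \<le> (\<Sum>l<m. card {xs :: bool list. length xs = l})"
    by (rule card_UN_le) simp
  also have "\<dots> = (\<Sum>l<m. 2 ^ l)"
    using card_lists_length_eq[of "UNIV :: bool set"] by simp
  also have "\<dots> < 2 ^ m"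
    by (induction m) auto
  finally show False using assms by (simp add: card_image)
qed

text \<open>Even labels form one path and odd labels the other, after a permutation that sends 0 to
  \<open>s\<close> and 1 to \<open>t\<close>.\<close>

lemma two_paths_in_lessThan:
  assumes "s < n" "t < n" "s \<noteq> t" "2 * k + 2 \<le> n"
  obtains a b where "two_paths a b k {..<n}" "a 0 = s" "b 0 = t"
proof -
  \<comment> \<open>The inner swap sends 1 to the preimage of \<open>t\<close> under the outer one;
    that preimage is not 0 because \<open>s \<noteq> t\<close>, so 0 still goes to
    \<open>s\<close>.\<close>
  define \<phi> where "\<phi> = transpose 0 s \<circ> transpose 1 (transpose 0 s t)"
  have inj: "inj \<phi>" by (simp add: \<phi>_def inj_compose)
  have \<phi>0: "\<phi> 0 = s" "\<phi> 1 = t" using assms by (auto simp: \<phi>_def transpose_def)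
  have less: "\<phi> x < n" if "x < n" for x
    using that assms by (auto simp: \<phi>_def transpose_def)
  have "two_paths (\<lambda>x. \<phi> (2 * x)) (\<lambda>x. \<phi> (2 * x + 1)) k {..<n}"
  proof
    show "(\<lambda>x. \<phi> (2 * x)) ` {..k} \<inter> (\<lambda>x. \<phi> (2 * x + 1)) ` {..k} = {}"
      by (auto simp: inj_eq[OF inj]) presburger
  qed (use less assms in \<open>auto simp: inj_on_def inj_eq[OF inj]\<close>)
  then show ?thesis using that \<phi>0 by simp
qed

theorem theorem9:
  shows "(\<exists>c::real. c > 0 \<and>
            (\<forall>\<^sub>F n in sequentially.
               \<exists>(G::nat wgraph) s t.
                 weighted_graph G \<and> card (verts G) = n \<and> s \<in> verts G \<and> t \<in> verts G \<and>
                 (\<forall>H. ft_preserver 2 G s t H \<longrightarrow> real (card (edges H)) \<ge> c * real n ^ 2)))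
       \<and> (\<exists>(c::real) (d::nat). c > 0 \<and>
            (\<forall>\<^sub>F n in sequentially.
               \<forall>W s t build query.
                 real ` {1..n ^ d} \<subseteq> W \<longrightarrow> s < n \<longrightarrow> t < n \<longrightarrow> s \<noteq> t \<longrightarrow>
                 exact_ft_oracle 2 (graphs_on n W) s t build query \<longrightarrow>
                 (\<exists>G \<in> graphs_on n W. real (length (build G)) \<ge> c * real n ^ 2)))"
proof -
  define k :: "nat \<Rightarrow> nat" where "k n = (n - 2) div 2" for n
  \<comment> \<open>Rounding gives \<open>k n \<ge> (n - 3) / 2\<close>, which is at least
    \<open>n / 4\<close> once \<open>n \<ge> 6\<close>. Squaring yields the constant 1/16.\<close>
  have k: "2 * k n + 2 \<le> n" "n / 4 \<le> k n" if "n \<ge> 6" for n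
    using that by (auto simp: k_def)
  have k_sq: "1 / 16 * real n ^ 2 \<le> m" if "n \<ge> 6" "k n ^ 2 \<le> m" for n m
  proof -
    have "1 / 16 * real n ^ 2 = (n / 4) ^ 2" by (simp add: power_divide)
    also have "\<dots> \<le> real (k n) ^ 2" using k[OF that(1)] by (intro power_mono) auto
    also have "\<dots> \<le> m" using that(2) by (metis of_nat_le_iff of_nat_power)
    finally show ?thesis .
  qed
  have preserver: "\<exists>(G::nat wgraph) s t.
      weighted_graph G \<and> card (verts G) = n \<and> s \<in> verts G \<and> t \<in> verts G \<and>
      (\<forall>H. ft_preserver 2 G s t H \<longrightarrow> real (card (edges H)) \<ge> 1 / 16 * real n ^ 2)"
    if n: "n \<ge> 6" for n
  proof -
    obtain a b where ab: "two_paths a b (k n) {..<n}" "a 0 = 0" "b 0 = 1"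
      using two_paths_in_lessThan[of 0 n 1 "k n"] k[OF n] n by auto
    interpret two_paths a b "k n" "{..<n}" by fact
    show ?thesis
      using weighted_graph_gadget[of grid] card_preserver ab n k_sq[OF n]
      by (intro exI[of _ "gadget grid"] exI[of _ 0] exI[of _ 1]) auto
  qed
  have space: "\<exists>G \<in> graphs_on n W. real (length (build G)) \<ge> 1 / 16 * real n ^ 2"
    if n: "n \<ge> 6" and W: "real ` {1..n ^ 2} \<subseteq> W" and st: "s < n" "t < n" "s \<noteq> t"
      and orc: "exact_ft_oracle 2 (graphs_on n W) s t build query"
    for n W s t and build :: "nat wgraph \<Rightarrow> bool list" and query
  proof -
    obtain a b where ab: "two_paths a b (k n) {..<n}" "a 0 = s" "b 0 = t"
      using two_paths_in_lessThan[OF st, of "k n"] k[OF n] by auto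
    interpret two_paths a b "k n" "{..<n}" by fact
    \<comment> \<open>The largest weights are linear in \<open>n\<close> with a factor near 4, so
      \<open>d = 2\<close> suffices.\<close>
    have "8 * k n \<le> 4 * n" using k[OF n] by simp
    also have "\<dots> \<le> n ^ 2" using n by (simp add: power2_eq_square)
    finally have "max 1 (8 * k n) \<le> n ^ 2" using n by simp
    then have "real ` {1..max 1 (8 * k n)} \<subseteq> W" using W by (force simp: image_subset_iff)
    then have "ran (weight (gadget S)) \<subseteq> W" if "S \<subseteq> grid" for S
      using ran_gadget[OF that] by (rule subset_trans[rotated])
    then have G: "gadget ` Pow grid \<subseteq> graphs_on n W"
      using weighted_graph_gadget by (auto simp: graphs_on_def)
    have "inj_on (\<lambda>S. build (gadget S)) (Pow grid)"
      using orc G ab by (intro inj_build) auto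
    moreover have "card (Pow grid) \<ge> 2 ^ (k n ^ 2)"
      by (simp add: card_Pow power2_eq_square)
    ultimately obtain S where "S \<in> Pow grid" "k n ^ 2 \<le> length (build (gadget S))"
      using ex_long_bit_string[of _ "Pow grid"] by force
    then show ?thesis using G k_sq[OF n] by blast
  qed
  show ?thesis
  proof (rule conjI)
    show "\<exists>c::real. c > 0 \<and>
        (\<forall>\<^sub>F n in sequentially.
           \<exists>(G::nat wgraph) s t.
             weighted_graph G \<and> card (verts G) = n \<and> s \<in> verts G \<and> t \<in> verts G \<and>
             (\<forall>H. ft_preserver 2 G s t H \<longrightarrow> real (card (edges H)) \<ge> c * real n ^ 2))"
      by (rule exI[of _ "1 / 16"], rule conjI, simp, rule eventually_sequentiallyI[of 6],
          rule preserver)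
    show "\<exists>(c::real) (d::nat). c > 0 \<and>
        (\<forall>\<^sub>F n in sequentially.
           \<forall>W s t build query.
             real ` {1..n ^ d} \<subseteq> W \<longrightarrow> s < n \<longrightarrow> t < n \<longrightarrow> s \<noteq> t \<longrightarrow>
             exact_ft_oracle 2 (graphs_on n W) s t build query \<longrightarrow>
             (\<exists>G \<in> graphs_on n W. real (length (build G)) \<ge> c * real n ^ 2))"
      by (rule exI[of _ "1 / 16"], rule exI[of _ 2], rule conjI, simp,
          rule eventually_sequentiallyI[of 6], intro allI impI, rule space)
  qed
qed

end
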